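(* Let $T$ be the complete $k$-ary tree with $k \ge 2$ and depth $d \ge 1$ (the rooted tree in which every non-leaf vertex has exactly $k$ children and all leaves are at distance $d$ from the root). Let $m = d \bmod 3$ and $t = (d-1) \bmod 3$. Then $\textrm{RED:LD}(T) = k+1$ if $d=1$; $\textrm{RED:LD}(T) = k^2+k$ if $d=2$; $\textrm{RED:LD}(T) = k^3+k^2+2$ if $d=3$; and for $d \ge 4$, $$\textrm{RED:LD}(T) = (1-m)(2-m) + k^t(k+1)\frac{k^{3\lceil d/3\rceil}-1}{k^3-1}.$$
   Context: $N(v)$ denotes the open neighborhood of $v$. A set $S \subseteq V(G)$ is a locating-dominating (LD) set if for all $u,v \in V(G)-S$: $N(v)\cap S \neq \varnothing$, and if $u \ne v$ then $N(v) \cap S \neq N(u) \cap S$. A RED:LD set is an LD set $S$ such that $S-\{v\}$ is an LD set for every $v \in S$. $\textrm{RED:LD}(G)$ is the minimum cardinality of a RED:LD set of $G$. *)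

theory Defs
  imports Complex_Main
begin

text \<open>
  A finite simple graph is given by its vertex set \<open>V\<close> and its set \<open>E\<close> of two-element edges.
  Symmetric digraphs are not used as the model because in them an edge traversed back and forth
  counts as a cycle, so that no graph with an edge would be a tree.
\<close>

definition simple_graph :: "'a set \<Rightarrow> 'a set set \<Rightarrow> bool" where
  "simple_graph V E \<longleftrightarrow>
     finite V \<and> (\<forall>e\<in>E. \<exists>u\<in>V. \<exists>v\<in>V. u \<noteq> v \<and> e = {u, v})"

definition nbhd :: "'a set \<Rightarrow> 'a set set \<Rightarrow> 'a \<Rightarrow> 'a set" where
  "nbhd V E v = {u \<in> V. {v, u} \<in> E}"

definition walk :: "'a set \<Rightarrow> 'a set set \<Rightarrow> 'a \<Rightarrow> 'a list \<Rightarrow> 'a \<Rightarrow> bool" where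
  "walk V E u p v \<longleftrightarrow>
     p \<noteq> [] \<and> hd p = u \<and> last p = v \<and> set p \<subseteq> V \<and> successively (\<lambda>x y. {x, y} \<in> E) p"

definition connected_graph :: "'a set \<Rightarrow> 'a set set \<Rightarrow> bool" where
  "connected_graph V E \<longleftrightarrow> V \<noteq> {} \<and> (\<forall>u\<in>V. \<forall>v\<in>V. \<exists>p. walk V E u p v)"

text \<open>A cycle is listed without repeating its initial vertex.\<close>

definition graph_cycle :: "'a set \<Rightarrow> 'a set set \<Rightarrow> 'a list \<Rightarrow> bool" where
  "graph_cycle V E c \<longleftrightarrow>
     length c \<ge> 3 \<and> distinct c \<and> walk V E (hd c) c (last c) \<and> {last c, hd c} \<in> E"

definition tree_graph :: "'a set \<Rightarrow> 'a set set \<Rightarrow> bool" where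
  "tree_graph V E \<longleftrightarrow>
     simple_graph V E \<and> connected_graph V E \<and> (\<nexists>c. graph_cycle V E c)"

text \<open>The length of a walk is its number of edges; only used for vertices joined by a walk.\<close>

definition graph_dist :: "'a set \<Rightarrow> 'a set set \<Rightarrow> 'a \<Rightarrow> 'a \<Rightarrow> nat" where
  "graph_dist V E u v = (LEAST n. \<exists>p. walk V E u p v \<and> length p = Suc n)"

definition children :: "'a set \<Rightarrow> 'a set set \<Rightarrow> 'a \<Rightarrow> 'a \<Rightarrow> 'a set" where
  "children V E r v = {u \<in> nbhd V E v. graph_dist V E r u = graph_dist V E r v + 1}"

text \<open>
  A leaf of a rooted tree is a vertex without children. Finiteness of \<open>V\<close> (part of
  \<open>tree_graph\<close>) excludes the infinite tree without leaves.
\<close>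

definition complete_kary_tree :: "nat \<Rightarrow> nat \<Rightarrow> 'a set \<Rightarrow> 'a set set \<Rightarrow> 'a \<Rightarrow> bool" where
  "complete_kary_tree k d V E r \<longleftrightarrow>
     tree_graph V E \<and> r \<in> V \<and>
     (\<forall>v\<in>V. children V E r v \<noteq> {} \<longrightarrow> card (children V E r v) = k) \<and>
     (\<forall>v\<in>V. children V E r v = {} \<longrightarrow> graph_dist V E r v = d)"

definition LD_set :: "'a set \<Rightarrow> 'a set set \<Rightarrow> 'a set \<Rightarrow> bool" where
  "LD_set V E S \<longleftrightarrow>
     S \<subseteq> V \<and>
     (\<forall>u\<in>V - S. \<forall>v\<in>V - S.
        nbhd V E v \<inter> S \<noteq> {} \<and> (u \<noteq> v \<longrightarrow> nbhd V E v \<inter> S \<noteq> nbhd V E u \<inter> S))"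

definition RED_LD_set :: "'a set \<Rightarrow> 'a set set \<Rightarrow> 'a set \<Rightarrow> bool" where
  "RED_LD_set V E S \<longleftrightarrow> LD_set V E S \<and> (\<forall>v\<in>S. LD_set V E (S - {v}))"

text \<open>Meaningful only if some RED:LD set exists; otherwise the value is unspecified.\<close>

definition RED_LD :: "'a set \<Rightarrow> 'a set set \<Rightarrow> nat" where
  "RED_LD V E = Min (card ` {S. RED_LD_set V E S})"

end

theory Submission
  imports Defs
begin

text \<open>
  In a graph without cycles of length 3 or 4, two neighbours of a vertex \<open>u\<close> are never both
  in the closed neighbourhood of another vertex. Hence the RED:LD sets are exactly the sets that
  meet every closed neighbourhood in at least two vertices (double domination).

  For the complete \<open>k\<close>-ary tree let \<open>t = (d - 1) mod 3\<close>. Below a vertex \<open>v\<close> of depth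
  \<open>j < d\<close>, double domination of the \<open>k\<close> children forces at least \<open>k + 1\<close> members of the set
  among \<open>v\<close>, its children and its grandchildren. These blocks, for \<open>j = t, t + 3, \<dots>, d - 1\<close>,
  partition the vertices of depth at least \<open>t\<close>; if \<open>t = 2\<close>, the root forces two further members
  of depth at most 1. The levels \<open>j\<close> and \<open>j + 1\<close>, together with the root and one of its children
  if \<open>t = 2\<close>, attain the bound.
\<close>

section \<open>RED:LD sets and double domination\<close>

definition closed_nbhd :: "'a set \<Rightarrow> 'a set set \<Rightarrow> 'a \<Rightarrow> 'a set" where
  "closed_nbhd V E v = insert v (nbhd V E v)"

text \<open>Two explicit witnesses replace a cardinality bound, so that they can be used directly
  and no finiteness has to be tracked.\<close>

definition double_dominating :: "'a set \<Rightarrow> 'a set set \<Rightarrow> 'a set \<Rightarrow> bool" where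
  "double_dominating V E S \<longleftrightarrow>
     S \<subseteq> V \<and> (\<forall>v\<in>V. \<exists>x y. x \<noteq> y \<and> {x, y} \<subseteq> closed_nbhd V E v \<inter> S)"

lemma double_dominatingE:
  assumes "double_dominating V E S" "v \<in> V"
  obtains x y where "x \<noteq> y" "{x, y} \<subseteq> closed_nbhd V E v \<inter> S"
  using assms unfolding double_dominating_def by meson

lemma simple_graph_edgeD:
  assumes "simple_graph V E" "{u, v} \<in> E"
  shows "u \<in> V" "v \<in> V" "u \<noteq> v"
  using assms by (fastforce simp: simple_graph_def doubleton_eq_iff)+

text \<open>Only the domination half of LD matters, so this holds in any graph. A member
  \<open>v\<close> must stay dominated when \<open>v\<close> itself is deleted. A vertex outside
  \<open>S\<close> has a neighbour \<open>w\<close> in \<open>S\<close> and must stay dominated when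
  \<open>w\<close> is deleted, which yields a second one.\<close>

lemma RED_LD_set_imp_double_dominating:
  assumes "RED_LD_set V E S"
  shows "double_dominating V E S"
  unfolding double_dominating_def
proof (intro conjI ballI)
  show "S \<subseteq> V"
    using assms by (auto simp: RED_LD_set_def LD_set_def)
  fix v assume v: "v \<in> V"
  show "\<exists>x y. x \<noteq> y \<and> {x, y} \<subseteq> closed_nbhd V E v \<inter> S"
  proof (cases "v \<in> S")
    case True
    then have "LD_set V E (S - {v})"
      using assms by (auto simp: RED_LD_set_def)
    then have "nbhd V E v \<inter> (S - {v}) \<noteq> {}"
      using v by (auto simp: LD_set_def)
    then show ?thesis
      using True by (auto simp: closed_nbhd_def)
  next
    case False
    then have "nbhd V E v \<inter> S \<noteq> {}"
      using v assms unfolding RED_LD_set_def LD_set_def by blast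
    then obtain w where w: "w \<in> nbhd V E v" "w \<in> S"
      by blast
    then have "LD_set V E (S - {w})"
      using assms by (auto simp: RED_LD_set_def)
    then have "nbhd V E v \<inter> (S - {w}) \<noteq> {}"
      using v False unfolding LD_set_def by blast
    then show ?thesis
      using w by (auto simp: closed_nbhd_def)
  qed
qed

text \<open>Two different such vertices would close a triangle \<open>u, w1, w2\<close> if one of
  them is \<open>v\<close>, and a 4-cycle \<open>u, w1, v, w2\<close> otherwise.\<close>

lemma tree_graph_common_neighbour_unique:
  assumes T: "tree_graph V E" and uv: "u \<in> V" "v \<in> V" "u \<noteq> v"
    and w: "w1 \<in> nbhd V E u" "w2 \<in> nbhd V E u" "w1 \<in> closed_nbhd V E v" "w2 \<in> closed_nbhd V E v"
  shows "w1 = w2"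
proof (rule ccontr)
  assume ne: "w1 \<noteq> w2"
  have sg: "simple_graph V E" and nocyc: "\<not> graph_cycle V E c" for c
    using T by (auto simp: tree_graph_def)
  have e: "{u, w1} \<in> E" "{u, w2} \<in> E" "{w1, u} \<in> E" "{w2, u} \<in> E" "w1 \<in> V" "w2 \<in> V"
    using w by (auto simp: nbhd_def insert_commute)
  have d: "u \<noteq> w1" "u \<noteq> w2"
    using simple_graph_edgeD(3)[OF sg] e by blast+
  show False
  proof (cases "w1 = v \<or> w2 = v")
    case True
    then have "{w1, w2} \<in> E"
      using w(3,4) ne by (auto simp: closed_nbhd_def nbhd_def insert_commute)
    then have "graph_cycle V E [u, w1, w2]"
      using e d ne uv by (auto simp: graph_cycle_def walk_def)
    then show False using nocyc by blast
  next
    case False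
    then have "{w1, v} \<in> E" "{v, w2} \<in> E"
      using w(3,4) by (auto simp: closed_nbhd_def nbhd_def insert_commute)
    then have "graph_cycle V E [u, w1, v, w2]"
      using e d ne uv False by (auto simp: graph_cycle_def walk_def)
    then show False using nocyc by blast
  qed
qed

text \<open>A vertex \<open>u\<close> outside \<open>S\<close> has two neighbours in
  \<open>S\<close>, and at most one of them lies in the closed neighbourhood of a given
  \<open>v\<close>. The other one distinguishes \<open>u\<close> from \<open>v\<close>. The vertex
  \<open>x\<close> is arbitrary, so that \<open>x\<close> outside \<open>S\<close> covers
  \<open>S\<close> itself.\<close>

lemma double_dominating_imp_LD_set_delete:
  assumes T: "tree_graph V E" and D: "double_dominating V E S"
  shows "LD_set V E (S - {x})"
proof -
  let ?S = "S - {x}"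
  have SV: "S \<subseteq> V"
    using D by (simp add: double_dominating_def)
  have two: "\<exists>a b. a \<noteq> b \<and> {a, b} \<subseteq> nbhd V E u \<inter> S" if u: "u \<in> V - S" for u
  proof -
    obtain a b where "a \<noteq> b" "{a, b} \<subseteq> closed_nbhd V E u \<inter> S"
      using double_dominatingE[OF D, of u] u by blast
    then show ?thesis
      using u by (intro exI[of _ a] exI[of _ b]) (auto simp: closed_nbhd_def)
  qed
  have private_nbr: "\<exists>w. w \<in> nbhd V E u \<and> w \<in> S \<and> w \<notin> closed_nbhd V E v"
    if u: "u \<in> V - S" and v: "v \<in> V" "u \<noteq> v" for u v
  proof -
    obtain a b where "a \<noteq> b" "{a, b} \<subseteq> nbhd V E u \<inter> S"
      using two[OF u] by blast
    then show ?thesis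
      using tree_graph_common_neighbour_unique[OF T _ v, of a b] u by blast
  qed
  have dom: "nbhd V E v \<inter> ?S \<noteq> {}" if v: "v \<in> V - ?S" for v
  proof (cases "v \<in> S")
    case True
    then have "v = x" using v by simp
    moreover obtain a b where "a \<noteq> b" "{a, b} \<subseteq> closed_nbhd V E v \<inter> S"
      using double_dominatingE[OF D, of v] v by blast
    ultimately show ?thesis
      by (auto simp: closed_nbhd_def)
  next
    case False
    then show ?thesis
      using two[of v] v by blast
  qed
  have outside: "nbhd V E u \<inter> ?S \<noteq> nbhd V E v \<inter> ?S"
    if u: "u \<in> V - S" and v: "v \<in> V - ?S" "u \<noteq> v" for u v
  proof -
    obtain w where w: "w \<in> nbhd V E u" "w \<in> S" "w \<notin> closed_nbhd V E v"
      using private_nbr[OF u, of v] v by blast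
    show ?thesis
    proof (cases "w = x")
      case False
      then show ?thesis using w by (auto simp: closed_nbhd_def)
    next
      \<comment> \<open>The separating neighbour is the deleted vertex. As \<open>x\<close> is not
        in the closed neighbourhood of \<open>v\<close>, \<open>v\<close> differs from
        \<open>x\<close> and is outside \<open>S\<close> too. A neighbour of \<open>v\<close>
        private against \<open>u\<close> then separates the two; it is not \<open>x\<close>, because
        \<open>x\<close> is adjacent to \<open>u\<close>.\<close>
      case True
      then have "v \<in> V - S"
        using v w by (auto simp: closed_nbhd_def)
      then obtain w' where "w' \<in> nbhd V E v" "w' \<in> S" "w' \<notin> closed_nbhd V E u"
        using private_nbr[of v u] u v by blast
      then show ?thesis
        using True w by (auto simp: closed_nbhd_def)
    qed
  qed
  \<comment> \<open>Outside \<open>?S\<close> the only possible member of \<open>S\<close> is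
    \<open>x\<close>, so at least one of \<open>u\<close>, \<open>v\<close> lies outside
    \<open>S\<close>.\<close>
  have "nbhd V E v \<inter> ?S \<noteq> nbhd V E u \<inter> ?S" if "u \<in> V - ?S" "v \<in> V - ?S" "u \<noteq> v" for u v
  proof (cases "u \<in> S")
    case True
    then have "v \<in> V - S" using that by blast
    then show ?thesis using outside[of v u] that by blast
  next
    case False
    then show ?thesis using outside[of u v] that by blast
  qed
  then show ?thesis
    using dom SV unfolding LD_set_def by blast
qed

lemma tree_graph_RED_LD_set_iff:
  assumes T: "tree_graph V E"
  shows "RED_LD_set V E S \<longleftrightarrow> double_dominating V E S"
proof
  assume "RED_LD_set V E S"
  then show "double_dominating V E S"
    by (rule RED_LD_set_imp_double_dominating)
next
  assume D: "double_dominating V E S"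
  have "LD_set V E S"
  proof (cases "S = V")
    case True
    then show ?thesis by (simp add: LD_set_def)
  next
    case False
    then obtain x where "x \<notin> S"
      using D by (auto simp: double_dominating_def)
    then show ?thesis
      using double_dominating_imp_LD_set_delete[OF T D, of x] by simp
  qed
  then show "RED_LD_set V E S"
    using double_dominating_imp_LD_set_delete[OF T D] by (simp add: RED_LD_set_def)
qed

section \<open>Depth in rooted trees\<close>

lemma walk_snoc:
  assumes "walk V E u p v" "{v, w} \<in> E" "w \<in> V"
  shows "walk V E u (p @ [w]) w"
  using assms by (auto simp: walk_def successively_append_iff)

lemma walk_butlast:
  assumes "walk V E u p v" "length p = Suc (Suc n)"
  obtains w where "walk V E u (butlast p) w" "{w, v} \<in> E" "w \<in> V" "length (butlast p) = Suc n"
proof -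
  define q where "q = butlast p"
  have p: "p = q @ [v]"
    using assms by (metis append_butlast_last_id q_def walk_def)
  have q: "q \<noteq> []" "length q = Suc n"
    using assms p by auto
  have "walk V E u q (last q)" "{last q, v} \<in> E" "last q \<in> V"
    using assms(1) q(1) unfolding p walk_def
    by (auto simp: successively_append_iff)
  then show ?thesis
    using that q unfolding q_def by blast
qed

locale rooted_tree =
  fixes V :: "'a set" and E :: "'a set set" and r :: 'a
  assumes tree: "tree_graph V E" and root: "r \<in> V"
begin

abbreviation depth :: "'a \<Rightarrow> nat" where "depth \<equiv> graph_dist V E r"
abbreviation kids :: "'a \<Rightarrow> 'a set" where "kids \<equiv> children V E r"

definition level :: "nat \<Rightarrow> 'a set" where "level n = {v \<in> V. depth v = n}"

lemma simple: "simple_graph V E" and fin: "finite V" and acyclic: "\<not> graph_cycle V E c"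
  using tree by (auto simp: tree_graph_def simple_graph_def)

lemma finite_level: "finite (level n)"
  using fin by (simp add: level_def)

lemma depth_le:
  assumes "walk V E r p v"
  shows "depth v \<le> length p - 1"
proof -
  have "length p = Suc (length p - 1)"
    using assms by (cases p) (auto simp: walk_def)
  then show ?thesis
    unfolding graph_dist_def using assms by (intro Least_le) blast
qed

lemma shortest_walk:
  assumes "v \<in> V"
  obtains p where "walk V E r p v" "length p = Suc (depth v)"
proof -
  obtain p where p: "walk V E r p v"
    using tree root assms unfolding tree_graph_def connected_graph_def by blast
  then have "length p = Suc (length p - 1)"
    by (cases p) (auto simp: walk_def)
  then have "\<exists>n p. walk V E r p v \<and> length p = Suc n"
    using p by blast
  then have "\<exists>p. walk V E r p v \<and> length p = Suc (depth v)"
    unfolding graph_dist_def by (rule LeastI_ex)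
  then show ?thesis using that by blast
qed

lemma depth_root: "depth r = 0"
  using depth_le[of "[r]" r] root by (simp add: walk_def)

lemma depth_zero: "v \<in> V \<Longrightarrow> depth v = 0 \<Longrightarrow> v = r"
  by (erule shortest_walk) (auto simp: walk_def length_Suc_conv)

lemma level_0: "level 0 = {r}"
  using depth_zero depth_root root by (auto simp: level_def)

lemma depth_edge_le:
  assumes "{u, v} \<in> E"
  shows "depth v \<le> Suc (depth u)"
proof -
  have uv: "u \<in> V" "v \<in> V" using simple_graph_edgeD[OF simple assms] by auto
  obtain p where "walk V E r p u" "length p = Suc (depth u)"
    using shortest_walk[OF uv(1)] .
  then show ?thesis
    using depth_le[OF walk_snoc[OF _ assms uv(2)]] by fastforce
qed

lemma parent_exists:
  assumes "v \<in> V" "depth v = Suc n"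
  obtains u where "u \<in> level n" "{u, v} \<in> E"
proof -
  obtain p where p: "walk V E r p v" "length p = Suc (Suc n)"
    using shortest_walk[OF assms(1)] assms(2) by metis
  obtain u where u: "walk V E r (butlast p) u" "{u, v} \<in> E" "u \<in> V" "length (butlast p) = Suc n"
    using walk_butlast[OF p] .
  have "depth u \<le> n"
    using depth_le[OF u(1)] u(4) by simp
  moreover have "Suc n \<le> Suc (depth u)"
    using depth_edge_le[OF u(2)] assms(2) by simp
  ultimately show ?thesis
    using that u by (auto simp: level_def)
qed

section \<open>Uniqueness of parents from acyclicity\<close>

text \<open>Climb from both ends to the parents until these coincide. The depth bound keeps the path
  disjoint from the deeper vertices attached to it, both in the induction and in
  \<open>parent_unique\<close>; length at least 3 is what \<open>graph_cycle\<close> demands when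
  the ends are adjacent.\<close>

lemma path_through_ancestors:
  assumes "u \<in> level n" "v \<in> level n" "u \<noteq> v"
  shows "\<exists>p. walk V E u p v \<and> distinct p \<and> length p \<ge> 3 \<and> (\<forall>x\<in>set p. depth x \<le> n)"
  using assms
proof (induction n arbitrary: u v)
  case 0
  then show ?case by (auto simp: level_0)
next
  case (Suc n)
  then have V: "u \<in> V" "v \<in> V" and dep: "depth u = Suc n" "depth v = Suc n"
    by (auto simp: level_def)
  obtain u' where u': "u' \<in> level n" "{u', u} \<in> E" using parent_exists[OF V(1) dep(1)] .
  obtain v' where v': "v' \<in> level n" "{v', v} \<in> E" using parent_exists[OF V(2) dep(2)] .
  have e: "{u, u'} \<in> E" using u' by (simp add: insert_commute)
  show ?case
  proof (cases "u' = v'")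
    case True
    have "walk V E u [u, u', v] v"
      using True e u' v' V by (auto simp: walk_def level_def)
    moreover have "distinct [u, u', v]"
      using Suc.prems(3) u' dep by (auto simp: level_def)
    ultimately show ?thesis
      using dep u' by (intro exI[of _ "[u, u', v]"]) (auto simp: level_def)
  next
    case False
    then obtain p where p: "walk V E u' p v'" "distinct p" "length p \<ge> 3" "\<forall>x\<in>set p. depth x \<le> n"
      using Suc.IH[OF u'(1) v'(1)] by blast
    have "walk V E u (u # p @ [v]) v"
      using p(1) e v' V unfolding walk_def
      by (auto simp: successively_append_iff successively_Cons)
    moreover have "distinct (u # p @ [v])"
      using p Suc.prems(3) dep by auto
    ultimately show ?thesis
      using dep p by (intro exI[of _ "u # p @ [v]"]) auto
  qed
qed

text \<open>Such an edge would close the path through the ancestors to a cycle.\<close>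

lemma no_edge_within_level:
  assumes "{u, v} \<in> E"
  shows "depth u \<noteq> depth v"
proof
  assume "depth u = depth v"
  then have "u \<in> level (depth u)" "v \<in> level (depth u)" "u \<noteq> v"
    using simple_graph_edgeD[OF simple assms] by (auto simp: level_def)
  then obtain p where p: "walk V E u p v" "distinct p" "length p \<ge> 3"
    using path_through_ancestors by blast
  then have "graph_cycle V E p"
    using assms by (auto simp: graph_cycle_def walk_def insert_commute)
  then show False using acyclic by blast
qed

text \<open>Two parents are joined by a path that stays at depth at most \<open>n\<close>. Adding
  \<open>w\<close>, which is deeper than all of that path, gives a cycle.\<close>

lemma parent_unique:
  assumes "u \<in> level n" "v \<in> level n" "w \<in> level (Suc n)" "{u, w} \<in> E" "{v, w} \<in> E"
  shows "u = v"
proof (rule ccontr)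
  assume "u \<noteq> v"
  then obtain p where p: "walk V E u p v" "distinct p" "length p \<ge> 3" "\<forall>x\<in>set p. depth x \<le> n"
    using path_through_ancestors[OF assms(1,2)] by blast
  have "graph_cycle V E (w # p)"
    using p assms unfolding graph_cycle_def walk_def
    by (auto simp: successively_Cons insert_commute level_def)
  then show False using acyclic by blast
qed

section \<open>Children and closed neighbourhoods\<close>

lemma mem_kids_iff: "u \<in> kids v \<longleftrightarrow> u \<in> V \<and> {v, u} \<in> E \<and> depth u = Suc (depth v)"
  by (auto simp: children_def nbhd_def)

lemma kids_subset: "kids v \<subseteq> V"
  by (auto simp: children_def nbhd_def)

lemma finite_kids: "finite (kids v)"
  using kids_subset fin by (rule finite_subset)

lemma kids_level: "v \<in> level n \<Longrightarrow> kids v \<subseteq> level (Suc n)"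
  using kids_subset by (auto simp: level_def mem_kids_iff)

lemma kids_subset_nbhd: "kids v \<subseteq> nbhd V E v"
  by (auto simp: children_def)

lemma level_Suc: "level (Suc n) = (\<Union>v\<in>level n. kids v)"
proof
  show "level (Suc n) \<subseteq> (\<Union>v\<in>level n. kids v)"
  proof
    fix w assume w: "w \<in> level (Suc n)"
    then obtain v where "v \<in> level n" "{v, w} \<in> E"
      using parent_exists[of w n] by (auto simp: level_def)
    then show "w \<in> (\<Union>v\<in>level n. kids v)"
      using w by (auto simp: mem_kids_iff level_def)
  qed
  show "(\<Union>v\<in>level n. kids v) \<subseteq> level (Suc n)"
    using kids_level by blast
qed

lemma kids_disjoint:
  assumes "u \<in> V" "v \<in> V" "u \<noteq> v"
  shows "kids u \<inter> kids v = {}"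
proof (rule ccontr)
  assume "kids u \<inter> kids v \<noteq> {}"
  then obtain w where w: "w \<in> kids u" "w \<in> kids v" by blast
  then have "w \<in> V" "u \<in> level (depth u)" "v \<in> level (depth u)" "w \<in> level (Suc (depth u))"
    using assms kids_subset by (auto simp: level_def mem_kids_iff)
  then show False
    using parent_unique[of u "depth u" v w] w assms by (auto simp: mem_kids_iff)
qed

text \<open>Adjacent depths differ by exactly one, so a neighbour of \<open>c\<close> is a child of
  \<open>c\<close> or a parent of \<open>c\<close>, and the parent is unique.\<close>

lemma closed_nbhd_kid:
  assumes "v \<in> V" "c \<in> kids v"
  shows "closed_nbhd V E c \<subseteq> insert v (insert c (kids c))"
proof
  fix x assume x: "x \<in> closed_nbhd V E c"
  show "x \<in> insert v (insert c (kids c))"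
  proof (cases "x = c")
    case False
    then have e: "{c, x} \<in> E" "{x, c} \<in> E" "x \<in> V"
      using x by (auto simp: closed_nbhd_def nbhd_def insert_commute)
    have c: "{v, c} \<in> E" "depth c = Suc (depth v)" "c \<in> V"
      using assms kids_subset by (auto simp: mem_kids_iff)
    have "depth x = Suc (depth c) \<or> depth x = depth v"
      using depth_edge_le[OF e(1)] depth_edge_le[OF e(2)] no_edge_within_level[OF e(1)] c(2) by linarith
    then show ?thesis
    proof
      assume "depth x = Suc (depth c)"
      then show ?thesis using e by (simp add: mem_kids_iff)
    next
      assume "depth x = depth v"
      then have "x = v"
        using parent_unique[of x "depth v" v c] e c assms(1) by (auto simp: level_def)
      then show ?thesis by simp
    qed
  qed simp
qed

lemma closed_nbhd_root: "closed_nbhd V E r \<subseteq> level 0 \<union> level 1"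
proof
  fix x assume x: "x \<in> closed_nbhd V E r"
  then have xV: "x \<in> V" using root by (auto simp: closed_nbhd_def nbhd_def)
  have "depth x \<le> 1"
    using x depth_edge_le[of r x] depth_root by (auto simp: closed_nbhd_def nbhd_def)
  then show "x \<in> level 0 \<union> level 1"
    using xV by (auto simp: level_def)
qed

text \<open>The closed neighbourhood of \<open>c\<close> contains two members of \<open>S\<close>,
  of which only \<open>v\<close> can lie outside \<open>insert c (kids c)\<close>.\<close>

lemma child_block_card_ge:
  assumes D: "double_dominating V E S" and v: "v \<in> V" and c: "c \<in> kids v"
  shows "(if v \<in> S then 1 else 2) \<le> card (S \<inter> insert c (kids c))"
proof -
  have fin': "finite (S \<inter> insert c (kids c))"
    using finite_kids by simp
  have "c \<in> V" using c kids_subset by blast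
  then obtain x y where xy: "x \<noteq> y" "{x, y} \<subseteq> closed_nbhd V E c \<inter> S"
    using double_dominatingE[OF D] by blast
  have sub: "{x, y} \<subseteq> insert v (S \<inter> insert c (kids c))"
    using xy(2) closed_nbhd_kid[OF v c] by blast
  show ?thesis
  proof (cases "v \<in> S")
    case True
    have "S \<inter> insert c (kids c) \<noteq> {}"
      using sub xy(1) by auto
    then show ?thesis
      using True fin' by (simp add: Suc_leI card_gt_0_iff)
  next
    case False
    then have "{x, y} \<subseteq> S \<inter> insert c (kids c)"
      using sub xy(2) by auto
    then show ?thesis
      using card_mono[OF fin', of "{x, y}"] xy(1) False by simp
  qed
qed

end

section \<open>Complete k-ary trees\<close>

locale kary_tree = rooted_tree V E r for V :: "'a set" and E r +
  fixes k d :: nat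
  assumes k: "k \<ge> 2" and d: "d \<ge> 1" and kary: "complete_kary_tree k d V E r"
begin

text \<open>The definition of the complete tree fixes only the depth of leaves. A vertex of maximal
  depth is a leaf, so the maximum is \<open>d\<close>.\<close>

lemma depth_le_d:
  assumes "v \<in> V"
  shows "depth v \<le> d"
proof -
  have ne: "depth ` V \<noteq> {}" "finite (depth ` V)"
    using root fin by auto
  obtain w where w: "w \<in> V" "depth w = Max (depth ` V)"
    using Max_in[OF ne(2,1)] by force
  have "kids w = {}"
  proof (rule ccontr)
    assume "kids w \<noteq> {}"
    then obtain u where "u \<in> kids w" by blast
    then have "u \<in> V" "depth u = Suc (depth w)"
      using kids_subset by (auto simp: mem_kids_iff)
    then show False
      using w(2) Max_ge[OF ne(2) imageI[of u V]] by simp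
  qed
  then have "depth w = d"
    using kary w(1) by (auto simp: complete_kary_tree_def)
  then show ?thesis
    using w(2) Max_ge[OF ne(2), of "depth v"] assms by simp
qed

lemma card_kids: "v \<in> V \<Longrightarrow> depth v < d \<Longrightarrow> card (kids v) = k"
  using kary unfolding complete_kary_tree_def by (metis less_irrefl)

lemma card_level: "n \<le> d \<Longrightarrow> card (level n) = k ^ n"
proof (induction n)
  case 0
  then show ?case by (simp add: level_0)
next
  case (Suc n)
  have "card (level (Suc n)) = (\<Sum>v\<in>level n. card (kids v))"
    unfolding level_Suc using finite_level finite_kids kids_disjoint
    by (intro card_UN_disjoint) (auto simp: level_def)
  also have "\<dots> = (\<Sum>v\<in>level n. k)"
    using Suc.prems by (intro sum.cong) (auto simp: level_def card_kids)
  finally show ?case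
    using Suc by simp
qed

section \<open>Lower bound from disjoint blocks\<close>

text \<open>The sets \<open>insert c (kids c)\<close> of the \<open>k\<close> children are disjoint.
  If \<open>v\<close> is in \<open>S\<close>, they contribute at least \<open>k\<close> and
  \<open>v\<close> one more; otherwise they contribute at least \<open>2 * k\<close>, which is at
  least \<open>k + 1\<close>.\<close>

lemma block_card_ge:
  assumes D: "double_dominating V E S" and v: "v \<in> V" "depth v < d"
  shows "k + 1 \<le> card (S \<inter> (insert v (\<Union>c\<in>kids v. insert c (kids c))))"
proof -
  let ?B = "\<lambda>c. S \<inter> insert c (kids c)"
  let ?e = "if v \<in> S then 1 else 2 :: nat"
  have disj: "?B c \<inter> ?B c' = {}" if "c \<in> kids v" "c' \<in> kids v" "c \<noteq> c'" for c c'
    using kids_disjoint[of c c'] that kids_subset by (auto simp: mem_kids_iff)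
  have fB: "finite (\<Union>c\<in>kids v. ?B c)"
    using finite_kids by simp
  have vB: "v \<notin> (\<Union>c\<in>kids v. ?B c)"
    by (auto simp: mem_kids_iff)
  have "k * ?e = (\<Sum>c\<in>kids v. ?e)"
    using card_kids[OF v] by simp
  also have "\<dots> \<le> (\<Sum>c\<in>kids v. card (?B c))"
    using child_block_card_ge[OF D v(1)] by (intro sum_mono) blast
  also have "\<dots> = card (\<Union>c\<in>kids v. ?B c)"
    using finite_kids disj by (intro card_UN_disjoint[symmetric]) auto
  finally have le: "k * ?e \<le> card (\<Union>c\<in>kids v. ?B c)" .
  have eq: "S \<inter> insert v (\<Union>c\<in>kids v. insert c (kids c)) =
        (if v \<in> S then insert v (\<Union>c\<in>kids v. ?B c) else (\<Union>c\<in>kids v. ?B c))"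
    by auto
  show ?thesis
    unfolding eq using le k fB vB by (cases "v \<in> S") simp_all
qed

text \<open>The blocks of the \<open>k ^ n\<close> vertices at depth \<open>n\<close> are disjoint
  and lie in three consecutive levels. For \<open>n = d - 1\<close> the level \<open>n + 2\<close>
  is empty, which does no harm.\<close>

lemma three_levels_card_ge:
  assumes D: "double_dominating V E S" and n: "n < d"
  shows "k ^ n * (k + 1) \<le> (\<Sum>i\<in>{n, n + 1, n + 2}. card (S \<inter> level i))"
proof -
  let ?B = "\<lambda>v. insert v (\<Union>c\<in>kids v. insert c (kids c))"
  have disj: "?B u \<inter> ?B v = {}" if uv: "u \<in> level n" "v \<in> level n" "u \<noteq> v" for u v
  proof -
    \<comment> \<open>The depth of a common element tells which layer it occupies in both blocks, so
      an overlap would give a vertex two parents or two grandparents.\<close>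
    have B: "depth x = n \<and> x = w \<or> depth x = Suc n \<and> x \<in> kids w \<or>
        depth x = Suc (Suc n) \<and> (\<exists>c. c \<in> kids w \<and> x \<in> kids c)"
      if "x \<in> ?B w" "w \<in> level n" for x w
      using that by (auto simp: mem_kids_iff level_def)
    have ku: "kids u \<inter> kids v = {}"
      using uv kids_disjoint by (auto simp: level_def)
    have kk: "kids c \<inter> kids c' = {}" if "c \<in> kids u" "c' \<in> kids v" for c c'
    proof (rule kids_disjoint)
      show "c \<in> V" "c' \<in> V" using that by (simp_all add: mem_kids_iff)
      show "c \<noteq> c'" using that ku by blast
    qed
    have False if x: "x \<in> ?B u" "x \<in> ?B v" for x
    proof -
      note Bu = B[OF x(1) uv(1)] and Bv = B[OF x(2) uv(2)]
      consider "depth x = n" | "depth x = Suc n" | "depth x = Suc (Suc n)"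
        using Bu by argo
      then show ?thesis
      proof cases
        case 1
        then show ?thesis using Bu Bv uv(3) by simp
      next
        case 2
        then have "x \<in> kids u" "x \<in> kids v" using Bu Bv by simp_all
        then show ?thesis using ku by blast
      next
        case 3
        then obtain c c' where c: "c \<in> kids u" "x \<in> kids c" "c' \<in> kids v" "x \<in> kids c'"
          using Bu Bv by auto
        then show ?thesis using kk[OF c(1,3)] by blast
      qed
    qed
    then show ?thesis by blast
  qed
  have sub: "(\<Union>v\<in>level n. S \<inter> ?B v) \<subseteq> (\<Union>i\<in>{n, n + 1, n + 2}. S \<inter> level i)"
    using level_Suc[of n] level_Suc[of "Suc n"] by auto
  have fB: "finite (?B v)" for v
    using finite_kids by simp
  have "k ^ n * (k + 1) = (\<Sum>v\<in>level n. k + 1)"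
    using card_level[of n] n by simp
  also have "\<dots> \<le> (\<Sum>v\<in>level n. card (S \<inter> ?B v))"
    using n by (intro sum_mono block_card_ge[OF D]) (auto simp: level_def)
  also have "\<dots> = card (\<Union>v\<in>level n. S \<inter> ?B v)"
  proof (rule card_UN_disjoint[symmetric])
    show "\<forall>u\<in>level n. \<forall>v\<in>level n. u \<noteq> v \<longrightarrow> (S \<inter> ?B u) \<inter> (S \<inter> ?B v) = {}"
      using disj by blast
  qed (use finite_level fB in auto)
  also have "\<dots> \<le> card (\<Union>i\<in>{n, n + 1, n + 2}. S \<inter> level i)"
    using sub finite_level by (intro card_mono) auto
  also have "\<dots> \<le> (\<Sum>i\<in>{n, n + 1, n + 2}. card (S \<inter> level i))"
    by (intro card_UN_le) simp
  finally show ?thesis .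
qed

text \<open>The bound \<open>n\<close> may exceed \<open>d + 1\<close>, since the last block
  formally ends one level below the leaves.\<close>

lemma card_eq_sum_levels:
  assumes "S \<subseteq> V" "n > d"
  shows "card S = (\<Sum>i<n. card (S \<inter> level i))"
proof -
  have "S = (\<Union>i\<in>{..<n}. S \<inter> level i)"
    using assms depth_le_d by (force simp: level_def)
  then have "card S = card (\<Union>i\<in>{..<n}. S \<inter> level i)" by simp
  also have "\<dots> = (\<Sum>i<n. card (S \<inter> level i))"
    using finite_level by (intro card_UN_disjoint) (auto simp: level_def)
  finally show ?thesis .
qed

text \<open>Here \<open>t\<close> and \<open>q\<close> are remainder and quotient of
  \<open>d - 1\<close> by 3. The \<open>q + 1\<close> layers of blocks start at depths
  \<open>t\<close>, \<open>t + 3\<close>, ..., and the last one starts at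
  \<open>d - 1\<close>.\<close>

context
  fixes t q :: nat
  assumes t: "t \<le> 2" and dq: "d = t + 3 * q + 1"
begin

lemma double_dominating_card_ge:
  assumes D: "double_dominating V E S"
  shows "(if t = 2 then 2 else 0) + (\<Sum>i\<le>q. k ^ (t + 3 * i) * (k + 1)) \<le> card S"
proof -
  let ?f = "\<lambda>i. card (S \<inter> level i)"
  have SV: "S \<subseteq> V" using D by (simp add: double_dominating_def)
  \<comment> \<open>For \<open>t = 2\<close> the levels 0 and 1 lie above all blocks and contain the
    whole closed neighbourhood of the root.\<close>
  have base: "(if t = 2 then 2 else 0) \<le> (\<Sum>i<t. ?f i)"
  proof (cases "t = 2")
    case True
    obtain x y where xy: "x \<noteq> y" "{x, y} \<subseteq> closed_nbhd V E r \<inter> S"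
      using double_dominatingE[OF D root] by blast
    then have "{x, y} \<subseteq> (S \<inter> level 0) \<union> (S \<inter> level 1)"
      using closed_nbhd_root by blast
    then have "card {x, y} \<le> card ((S \<inter> level 0) \<union> (S \<inter> level 1))"
      using finite_level by (intro card_mono) auto
    also have "\<dots> \<le> ?f 0 + ?f 1" by (rule card_Un_le)
    finally show ?thesis using True xy(1) by (simp add: numeral_2_eq_2)
  qed simp
  \<comment> \<open>Induction over the layers of blocks: each step adds three levels.\<close>
  have "(if t = 2 then 2 else 0) + (\<Sum>i\<le>p. k ^ (t + 3 * i) * (k + 1)) \<le> (\<Sum>i<t + 3 * p + 3. ?f i)"
    if "p \<le> q" for p
    using that
  proof (induction p)
    case 0
    then show ?case
      using base three_levels_card_ge[OF D, of t] dq by (simp add: numeral_3_eq_3)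
  next
    case (Suc p)
    have "t + 3 * Suc p < d" using Suc.prems dq by simp
    note three_levels_card_ge[OF D this]
    moreover have "(\<Sum>i<t + 3 * Suc p + 3. ?f i) =
        (\<Sum>i<t + 3 * p + 3. ?f i) + (\<Sum>i\<in>{t + 3 * Suc p, t + 3 * Suc p + 1, t + 3 * Suc p + 2}. ?f i)"
      by (simp add: numeral_3_eq_3)
    ultimately show ?case
      using Suc by simp
  qed
  from this[of q] show ?thesis
    using card_eq_sum_levels[OF SV, of "t + 3 * q + 3"] dq by simp
qed

section \<open>A set attaining the bound\<close>

lemma double_dominating_attained:
  "\<exists>S. double_dominating V E S \<and>
       card S \<le> (if t = 2 then 2 else 0) + (\<Sum>i\<le>q. k ^ (t + 3 * i) * (k + 1))"
proof -
  have two_kids: "\<exists>x y. x \<noteq> y \<and> {x, y} \<subseteq> kids v" if "v \<in> V" "depth v < d" for v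
  proof -
    have "\<not> is_singleton (kids v)" "kids v \<noteq> {}"
      using card_kids[OF that] k by (auto simp: is_singleton_altdef)
    then show ?thesis
      by (metis empty_subsetI insert_subset is_singletonI')
  qed
  obtain c where c: "c \<in> kids r"
    using two_kids[OF root] depth_root d by auto
  \<comment> \<open>For \<open>t = 2\<close>, \<open>S0\<close> starts at depth 2 and misses the
    closed neighbourhood of the root, so the root and one child are added.\<close>
  define X where "X = (if t = 2 then {r, c} else {})"
  define S0 where "S0 = (\<Union>i\<le>q. level (t + 3 * i) \<union> level (t + 3 * i + 1))"
  have "double_dominating V E (X \<union> S0)"
    unfolding double_dominating_def
  proof (intro conjI ballI)
    show "X \<union> S0 \<subseteq> V"
      using root c kids_subset by (auto simp: X_def S0_def level_def)
    fix v assume v: "v \<in> V"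
    have dv: "depth v \<le> t + 3 * q + 1" using depth_le_d[OF v] dq by simp
    have memS: "x \<in> S0" if "x \<in> V" "depth x = t + 3 * i \<or> depth x = t + 3 * i + 1" "i \<le> q" for x i
      using that by (auto simp: S0_def level_def)
    \<comment> \<open>\<open>upper\<close> and \<open>lower\<close> are the two chosen levels of a
      block. \<open>above\<close> is the level just over a block: depth \<open>t - 1\<close>, or the
      unchosen third level of the preceding block. The two witnesses are, in order: the root and
      \<open>c\<close>; two children; \<open>v\<close> and a child; \<open>v\<close> and its
      parent.\<close>
    consider (root) "t = 2" "depth v = 0" | (above) i where "Suc (depth v) = t + 3 * i" "i \<le> q"
      | (upper) i where "depth v = t + 3 * i" "i \<le> q"
      | (lower) i where "depth v = t + 3 * i + 1" "i \<le> q"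
    proof -
      consider "t = 2" "depth v = 0" | "Suc (depth v) = t" | "depth v \<ge> t"
        using t by linarith
      then show thesis
      proof cases
        case 1
        then show ?thesis using root by blast
      next
        case 2
        then show ?thesis using above[of 0] by simp
      next
        case 3
        then obtain s where s: "depth v = t + s" using le_Suc_ex by blast
        \<comment> \<open>The last alternative, residue 2, leads to the next block;
          \<open>s \<le> 3 * q + 1\<close> guarantees that this block exists.\<close>
        have "s = 3 * (s div 3) \<or> s = 3 * (s div 3) + 1 \<or> Suc s = 3 * Suc (s div 3)"
          by presburger
        moreover have "s \<le> 3 * q + 1" using s dv by simp
        ultimately show ?thesis
          using above[of "Suc (s div 3)"] upper[of "s div 3"] lower[of "s div 3"] s by fastforce
      qed
    qed
    then show "\<exists>x y. x \<noteq> y \<and> {x, y} \<subseteq> closed_nbhd V E v \<inter> (X \<union> S0)"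
    proof cases
      case root
      then have "v = r" using depth_zero v by blast
      then show ?thesis
        using root(1) c kids_subset_nbhd[of r]
        by (intro exI[of _ r] exI[of _ c]) (auto simp: X_def closed_nbhd_def mem_kids_iff)
    next
      case (above i)
      then have "depth v < d" using dq by simp
      then obtain x y where xy: "x \<noteq> y" "{x, y} \<subseteq> kids v" using two_kids[OF v] by blast
      then have "{x, y} \<subseteq> S0"
        using above memS[of _ i] kids_subset by (auto simp: mem_kids_iff)
      then show ?thesis
        using xy kids_subset_nbhd[of v] by (auto simp: closed_nbhd_def)
    next
      case (upper i)
      then have "depth v < d" using dq by simp
      then obtain x where x: "x \<in> kids v" using two_kids[OF v] by blast
      then have "x \<in> S0" "v \<in> S0" "x \<noteq> v"
        using upper v memS[of _ i] kids_subset by (auto simp: mem_kids_iff)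
      then show ?thesis
        using x kids_subset_nbhd[of v] by (auto simp: closed_nbhd_def)
    next
      case (lower i)
      then obtain u where u: "u \<in> level (t + 3 * i)" "{u, v} \<in> E"
        using parent_exists[OF v, of "t + 3 * i"] by auto
      then have "u \<in> S0" "v \<in> S0" "u \<noteq> v" "u \<in> nbhd V E v"
        using lower v memS[of _ i] by (auto simp: level_def nbhd_def insert_commute)
      then show ?thesis
        by (auto simp: closed_nbhd_def)
    qed
  qed
  moreover have "card (X \<union> S0) \<le> (if t = 2 then 2 else 0) + (\<Sum>i\<le>q. k ^ (t + 3 * i) * (k + 1))"
  proof -
    have "card X \<le> (if t = 2 then 2 else 0)"
      by (auto simp: X_def card_insert_if)
    moreover have "card S0 \<le> (\<Sum>i\<le>q. k ^ (t + 3 * i) * (k + 1))"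
    proof -
      have "card S0 \<le> (\<Sum>i\<le>q. card (level (t + 3 * i) \<union> level (t + 3 * i + 1)))"
        unfolding S0_def by (intro card_UN_le) simp
      also have "\<dots> \<le> (\<Sum>i\<le>q. k ^ (t + 3 * i) * (k + 1))"
      proof (rule sum_mono)
        fix i assume "i \<in> {..q}"
        then have "card (level (t + 3 * i)) = k ^ (t + 3 * i)"
          "card (level (t + 3 * i + 1)) = k ^ (t + 3 * i + 1)"
          using dq card_level by simp_all
        then show "card (level (t + 3 * i) \<union> level (t + 3 * i + 1)) \<le> k ^ (t + 3 * i) * (k + 1)"
          using card_Un_le[of "level (t + 3 * i)" "level (t + 3 * i + 1)"] by (simp add: mult.commute)
      qed
      finally show ?thesis .
    qed
    ultimately show ?thesis
      using card_Un_le[of X S0] by linarith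
  qed
  ultimately show ?thesis by blast
qed

lemma RED_LD_eq:
  "RED_LD V E = (if t = 2 then 2 else 0) + (\<Sum>i\<le>q. k ^ (t + 3 * i) * (k + 1))" (is "_ = ?N")
proof -
  have "{S. RED_LD_set V E S} = {S. double_dominating V E S}"
    using tree_graph_RED_LD_set_iff[OF tree] by blast
  moreover have "Min (card ` {S. double_dominating V E S}) = ?N"
  proof (rule Min_eqI)
    have "{S. double_dominating V E S} \<subseteq> Pow V"
      by (auto simp: double_dominating_def)
    then show "finite (card ` {S. double_dominating V E S})"
      using fin by (meson finite_Pow_iff finite_imageI finite_subset)
    show "?N \<le> y" if "y \<in> card ` {S. double_dominating V E S}" for y
      using that double_dominating_card_ge by blast
    show "?N \<in> card ` {S. double_dominating V E S}"
    proof -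
      obtain S where "double_dominating V E S" "card S \<le> ?N"
        using double_dominating_attained by blast
      then show ?thesis
        using double_dominating_card_ge[of S] by (intro image_eqI[of _ _ S]) auto
    qed
  qed
  ultimately show ?thesis
    by (simp add: RED_LD_def)
qed

end

end

section \<open>Closed form of the block sum\<close>

lemma sum_power_step:
  fixes x :: real
  assumes "x ^ s \<noteq> 1"
  shows "(\<Sum>i\<le>n. x ^ (t + s * i) * c) = x ^ t * c * ((x ^ (s * Suc n) - 1) / (x ^ s - 1))"
proof -
  have "(\<Sum>i\<le>n. x ^ (t + s * i) * c) = x ^ t * c * (\<Sum>i<Suc n. (x ^ s) ^ i)"
    unfolding sum_distrib_left lessThan_Suc_atMost
    by (simp add: power_add power_mult[symmetric] mult_ac)
  then show ?thesis
    unfolding geometric_sum[OF assms] power_mult .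
qed

theorem theorem17:
  fixes V :: "'a set" and E :: "'a set set" and r :: 'a and k d m t :: nat
  assumes "k \<ge> 2" and "d \<ge> 1"
    and "complete_kary_tree k d V E r"
    and "m = d mod 3" and "t = (d - 1) mod 3"
  shows "(d = 1 \<longrightarrow> RED_LD V E = k + 1) \<and>
         (d = 2 \<longrightarrow> RED_LD V E = k ^ 2 + k) \<and>
         (d = 3 \<longrightarrow> RED_LD V E = k ^ 3 + k ^ 2 + 2) \<and>
         (d \<ge> 4 \<longrightarrow>
            real (RED_LD V E) =
              (1 - real m) * (2 - real m)
              + real k ^ t * (real k + 1)
                * ((real k ^ (3 * nat \<lceil>real d / 3\<rceil>) - 1) / (real k ^ 3 - 1)))"
proof -
  interpret kary_tree V E r k d
    using assms by unfold_locales (auto simp: complete_kary_tree_def)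
  define q where "q = (d - 1) div 3"
  have t: "t \<le> 2" and dq: "d = t + 3 * q + 1"
    using assms(2,5) by (auto simp: q_def)
  note R = RED_LD_eq[OF t dq]
  have "real k ^ 3 \<noteq> 1"
    using one_less_power[of "real k" 3] assms(1) by linarith
  note S = sum_power_step[OF this, of t "real k + 1" q]
  \<comment> \<open>\<open>d / 3\<close> equals \<open>q + (t + 1) / 3\<close>, and
    \<open>t + 1\<close> lies between 1 and 3.\<close>
  have "\<lceil>real d / 3\<rceil> = int (Suc q)"
    using t by (intro ceiling_unique) (auto simp: dq field_simps)
  then have c: "nat \<lceil>real d / 3\<rceil> = Suc q" by simp
  have "m = (t + 1) mod 3"
    using assms(4) dq by presburger
  \<comment> \<open>The product vanishes for \<open>m = 1\<close> and \<open>m = 2\<close> and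
    equals 2 for \<open>m = 0\<close>, that is, for \<open>t = 2\<close>.\<close>
  then have e: "(1 - real m) * (2 - real m) = real (if t = 2 then 2 else 0)"
    using t by (auto simp: le_Suc_eq numeral_2_eq_2)
  have "real (RED_LD V E) = (1 - real m) * (2 - real m)
     + real k ^ t * (real k + 1) * ((real k ^ (3 * nat \<lceil>real d / 3\<rceil>) - 1) / (real k ^ 3 - 1))"
    unfolding c e R S[symmetric] by (simp add: algebra_simps)
  moreover have "RED_LD V E = k + 1" if "d = 1"
    using R dq that by simp
  moreover have "RED_LD V E = k ^ 2 + k" if "d = 2"
  proof -
    have "t = 1" "q = 0" using that assms(5) by (simp_all add: q_def)
    then show ?thesis using R by (simp add: power2_eq_square)
  qed
  moreover have "RED_LD V E = k ^ 3 + k ^ 2 + 2" if "d = 3"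
  proof -
    have "t = 2" "q = 0" using that assms(5) by (simp_all add: q_def)
    then show ?thesis using R by (simp add: power2_eq_square power3_eq_cube algebra_simps)
  qed
  ultimately show ?thesis by blast
qed

end
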